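(* Let $S$ be a topological semigroup. If $S$ is character amenable, then $S$ is amenable.
   Context: A character on a topological semigroup $S$ is a nonzero continuous map $\varphi:S\to\mathbb{T}$ (the unit circle) with $\varphi(st)=\varphi(s)\varphi(t)$ for all $s,t\in S$; $\Delta_S(S)$ is the set of characters. A Banach $S$-bimodule is a Banach space $X$ with commuting left and right actions $(s,x)\mapsto s\cdot x$, $(x,s)\mapsto x\cdot s$ of $S$ by linear operators, which are separately continuous and uniformly bounded in $s$. The dual $X^*$ is a bimodule via $(s\cdot f)(x)=f(x\cdot s)$, $(f\cdot s)(x)=f(s\cdot x)$. Let ${}_\varphi\mathcal{M}^S$ (resp. $\mathcal{M}_\varphi^S$) be the class of Banach $S$-bimodules $X$ with $s\cdot x=\varphi(s)x$ (resp. $x\cdot s=\varphi(s)x$) for all $s\in S,x\in X$. A bounded derivation is a weak$^*$-continuous map $D:S\to X^*$ with $D(st)=s\cdot D(t)+D(s)\cdot t$ for all $s,t\in S$ and $\sup_{s}\|D(s)\|<\infty$; it is principal if there is $f\in X^*$ with $D(s)=s\cdot f-f\cdot s$ for all $s\in S$. $S$ is left (resp. right) character amenable if for each $\varphi\in\Delta_S(S)$ and each $X\in\mathcal{M}_\varphi^S$ (resp. $X\in{}_\varphi\mathcal{M}^S$), every bounded derivation $D:S\to X^*$ is principal; $S$ is character amenable if it is both left and right character amenable. $C(S)$ is the Banach algebra of bounded continuous complex functions on $S$; for $f\in C(S)$, $s,t\in S$ put $(f\cdot s)(t)=f(st)$ and $(s\cdot f)(t)=f(ts)$. $RUC(S)$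 (resp. $LUC(S)$) is the set of $f\in C(S)$ such that $\|f\cdot s_\alpha-f\cdot s\|_\infty\to0$ (resp. $\|s_\alpha\cdot f-s\cdot f\|_\infty\to0$) whenever $s_\alpha\to s$ in $S$. $S$ is left (resp. right) amenable if there is $m\in RUC(S)^*$ (resp. $m\in LUC(S)^*$) with $m(1_S)=\|m\|=1$ and $m(f\cdot s)=m(f)$ (resp. $m(s\cdot f)=m(f)$) for all $f$ and all $s\in S$; $S$ is amenable if it is both left and right amenable. *)

theory Defs
  imports
    "HOL-Analysis.Analysis"
    "HOL-Algebra.Module"
begin

section \<open>Complex normed spaces and their duals\<close>

text \<open>
  A complex vector space is a module over the field of complex numbers, so that Banach spaces
  can be quantified over inside a formula. A module record also carries the fields
  \<^const>\<open>monoid.mult\<close> and \<^const>\<open>monoid.one\<close>, about which nothing is assumed and which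
  are never used.
\<close>

definition complex_ring :: "complex ring" where
  "complex_ring = \<lparr>carrier = UNIV, monoid.mult = (*), one = 1, zero = 0, add = (+)\<rparr>"

record 'x normed_module = "(complex, 'x) module" +
  nrm :: "'x \<Rightarrow> real"

locale cnormed_space =
  Module.module complex_ring X
  for X :: "('x, 'm) normed_module_scheme" (structure) +
  assumes nrm_eq_0_iff: "x \<in> carrier X \<Longrightarrow> nrm X x = 0 \<longleftrightarrow> x = \<zero>"
    and nrm_triangle: "\<lbrakk>x \<in> carrier X; y \<in> carrier X\<rbrakk> \<Longrightarrow> nrm X (x \<oplus> y) \<le> nrm X x + nrm X y"
    and nrm_smult: "x \<in> carrier X \<Longrightarrow> nrm X (c \<odot> x) = cmod c * nrm X x"

text \<open>
  The locale \<^locale>\<open>Metric_space\<close> asks for a nonnegative symmetric function on the whole type,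
  hence the value 0 outside the carrier.
\<close>

definition ndist :: "('x, 'm) normed_module_scheme \<Rightarrow> 'x \<Rightarrow> 'x \<Rightarrow> real" where
  "ndist X x y = (if x \<in> carrier X \<and> y \<in> carrier X then nrm X (x \<ominus>\<^bsub>X\<^esub> y) else 0)"

abbreviation ntopology :: "('x, 'm) normed_module_scheme \<Rightarrow> 'x topology" where
  "ntopology X \<equiv> Metric_space.mtopology (carrier X) (ndist X)"

definition cbanach_space :: "('x, 'm) normed_module_scheme \<Rightarrow> bool" where
  "cbanach_space X \<longleftrightarrow> cnormed_space X \<and> Metric_space.mcomplete (carrier X) (ndist X)"

text \<open>
  Functionals are total functions on the type \<open>'x\<close>, of which only the values on the carrier matter;
  equality of functionals therefore means agreement on the carrier.
\<close>

definition dual :: "('x, 'm) normed_module_scheme \<Rightarrow> ('x \<Rightarrow> complex) set" where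
  "dual X = {f. (\<forall>x\<in>carrier X. \<forall>y\<in>carrier X. f (x \<oplus>\<^bsub>X\<^esub> y) = f x + f y)
              \<and> (\<forall>c. \<forall>x\<in>carrier X. f (c \<odot>\<^bsub>X\<^esub> x) = c * f x)
              \<and> (\<exists>K. \<forall>x\<in>carrier X. cmod (f x) \<le> K * nrm X x)}"

definition dual_norm :: "('x, 'm) normed_module_scheme \<Rightarrow> ('x \<Rightarrow> complex) \<Rightarrow> real" where
  "dual_norm X f = (SUP x\<in>{x \<in> carrier X. nrm X x \<le> 1}. cmod (f x))"


section \<open>Banach bimodules over a topological semigroup\<close>

record ('s, 'x) bimodule = "'x normed_module" +
  lact :: "'s \<Rightarrow> 'x \<Rightarrow> 'x"
  ract :: "'x \<Rightarrow> 's \<Rightarrow> 'x"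

definition linear_operator :: "('x, 'm) normed_module_scheme \<Rightarrow> ('x \<Rightarrow> 'x) \<Rightarrow> bool" where
  "linear_operator X T \<longleftrightarrow>
     T \<in> carrier X \<rightarrow> carrier X
     \<and> (\<forall>x\<in>carrier X. \<forall>y\<in>carrier X. T (x \<oplus>\<^bsub>X\<^esub> y) = T x \<oplus>\<^bsub>X\<^esub> T y)
     \<and> (\<forall>c. \<forall>x\<in>carrier X. T (c \<odot>\<^bsub>X\<^esub> x) = c \<odot>\<^bsub>X\<^esub> T x)"

locale banach_bimodule =
  fixes X :: "('s::topological_semigroup_mult, 'x) bimodule"
  assumes banach: "cbanach_space X"
    and lact_linear: "linear_operator X (\<lambda>x. lact X s x)"
    and ract_linear: "linear_operator X (\<lambda>x. ract X x s)"
    and lact_lact: "x \<in> carrier X \<Longrightarrow> lact X (s * t) x = lact X s (lact X t x)"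
    and ract_ract: "x \<in> carrier X \<Longrightarrow> ract X x (s * t) = ract X (ract X x s) t"
    and lact_ract: "x \<in> carrier X \<Longrightarrow> ract X (lact X s x) t = lact X s (ract X x t)"
    and lact_continuous: "continuous_map (ntopology X) (ntopology X) (\<lambda>x. lact X s x)"
      "x \<in> carrier X \<Longrightarrow> continuous_map euclidean (ntopology X) (\<lambda>s. lact X s x)"
    and ract_continuous: "continuous_map (ntopology X) (ntopology X) (\<lambda>x. ract X x s)"
      "x \<in> carrier X \<Longrightarrow> continuous_map euclidean (ntopology X) (\<lambda>s. ract X x s)"
    and lact_bounded: "\<exists>K. \<forall>s. \<forall>x\<in>carrier X. nrm X (lact X s x) \<le> K * nrm X x"
    and ract_bounded: "\<exists>K. \<forall>s. \<forall>x\<in>carrier X. nrm X (ract X x s) \<le> K * nrm X x"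

definition dual_lact :: "('s, 'x) bimodule \<Rightarrow> 's \<Rightarrow> ('x \<Rightarrow> complex) \<Rightarrow> 'x \<Rightarrow> complex" where
  "dual_lact X s f = (\<lambda>x. f (ract X x s))"

definition dual_ract :: "('s, 'x) bimodule \<Rightarrow> ('x \<Rightarrow> complex) \<Rightarrow> 's \<Rightarrow> 'x \<Rightarrow> complex" where
  "dual_ract X f s = (\<lambda>x. f (lact X s x))"

text \<open>The third conjunct is continuity for the weak* topology of the dual.\<close>

definition bounded_derivation ::
    "('s::topological_semigroup_mult, 'x) bimodule \<Rightarrow> ('s \<Rightarrow> 'x \<Rightarrow> complex) \<Rightarrow> bool" where
  "bounded_derivation X D \<longleftrightarrow>
     range D \<subseteq> dual X
     \<and> (\<forall>s t. \<forall>x\<in>carrier X. D (s * t) x = dual_lact X s (D t) x + dual_ract X (D s) t x)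
     \<and> (\<forall>x\<in>carrier X. continuous_on UNIV (\<lambda>s. D s x))
     \<and> bdd_above (range (\<lambda>s. dual_norm X (D s)))"

definition principal_derivation ::
    "('s, 'x) bimodule \<Rightarrow> ('s \<Rightarrow> 'x \<Rightarrow> complex) \<Rightarrow> bool" where
  "principal_derivation X D \<longleftrightarrow>
     (\<exists>f\<in>dual X. \<forall>s. \<forall>x\<in>carrier X. D s x = dual_lact X s f x - dual_ract X f s x)"


section \<open>Character amenability\<close>

definition characters :: "('s::topological_semigroup_mult \<Rightarrow> complex) set" where
  "characters = {\<phi>. continuous_on UNIV \<phi> \<and> range \<phi> \<subseteq> sphere 0 1 \<and> \<phi> \<noteq> (\<lambda>_. 0)
                  \<and> (\<forall>s t. \<phi> (s * t) = \<phi> s * \<phi> t)}"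

text \<open>The classes written \<open>\<^sub>\<phi>M\<^sup>S\<close> and \<open>M\<^sub>\<phi>\<^sup>S\<close>, with modules carried by subsets of \<open>'x\<close>.\<close>

definition left_char_modules ::
    "('s::topological_semigroup_mult \<Rightarrow> complex) \<Rightarrow> ('s, 'x) bimodule set" where
  "left_char_modules \<phi> =
     {X. banach_bimodule X \<and> (\<forall>s. \<forall>x\<in>carrier X. lact X s x = \<phi> s \<odot>\<^bsub>X\<^esub> x)}"

definition right_char_modules ::
    "('s::topological_semigroup_mult \<Rightarrow> complex) \<Rightarrow> ('s, 'x) bimodule set" where
  "right_char_modules \<phi> =
     {X. banach_bimodule X \<and> (\<forall>s. \<forall>x\<in>carrier X. ract X x s = \<phi> s \<odot>\<^bsub>X\<^esub> x)}"

text \<open>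
  A formula cannot quantify over types, so the Banach bimodules range over those with carrier a
  subset of \<open>'s \<Rightarrow> complex\<close>, with arbitrary operations and norm. This loses nothing: assume all
  bounded derivations are principal for these modules, and let \<open>X\<close> be any module in the class.
  A closed submodule \<open>Y\<close> of \<open>X\<close> generated by at most \<open>max \<aleph>\<^sub>0 |S|\<close> elements has at most
  \<open>(max \<aleph>\<^sub>0 |S|) ^ \<aleph>\<^sub>0 \<le> |'s \<Rightarrow> complex|\<close> points, so a derivation \<open>D\<close> restricted to \<open>Y\<close> is
  implemented by some \<open>f\<close> in the dual of \<open>Y\<close>. The norms of such \<open>f\<close> can be bounded uniformly in
  \<open>Y\<close> (otherwise countably many \<open>Y\<close> generate one for which there is no \<open>f\<close>), and a weak* cluster
  point of their Hahn-Banach extensions implements \<open>D\<close> on \<open>X\<close>.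
\<close>

definition left_character_amenable :: "'s::topological_semigroup_mult itself \<Rightarrow> bool" where
  "left_character_amenable S \<longleftrightarrow>
     (\<forall>\<phi>\<in>characters. \<forall>X \<in> (right_char_modules \<phi> :: ('s, 's \<Rightarrow> complex) bimodule set).
        \<forall>D. bounded_derivation X D \<longrightarrow> principal_derivation X D)"

definition right_character_amenable :: "'s::topological_semigroup_mult itself \<Rightarrow> bool" where
  "right_character_amenable S \<longleftrightarrow>
     (\<forall>\<phi>\<in>characters. \<forall>X \<in> (left_char_modules \<phi> :: ('s, 's \<Rightarrow> complex) bimodule set).
        \<forall>D. bounded_derivation X D \<longrightarrow> principal_derivation X D)"

definition character_amenable :: "'s::topological_semigroup_mult itself \<Rightarrow> bool" where
  "character_amenable S \<longleftrightarrow> left_character_amenable S \<and> right_character_amenable S"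


section \<open>Amenability\<close>

definition sup_norm :: "('s \<Rightarrow> complex) \<Rightarrow> real" where
  "sup_norm f = (SUP t. cmod (f t))"

text \<open>A linear space \<open>A\<close> of bounded functions, with pointwise operations and the sup norm.\<close>

definition fun_space :: "('s \<Rightarrow> complex) set \<Rightarrow> ('s \<Rightarrow> complex) normed_module" where
  "fun_space A =
     \<lparr>carrier = A, monoid.mult = (\<lambda>f g t. f t * g t), one = (\<lambda>_. 1), zero = (\<lambda>_. 0),
      add = (\<lambda>f g t. f t + g t), smult = (\<lambda>c f t. c * f t), nrm = sup_norm\<rparr>"

definition fun_ract :: "('s::semigroup_mult \<Rightarrow> complex) \<Rightarrow> 's \<Rightarrow> 's \<Rightarrow> complex" where
  "fun_ract f s = (\<lambda>t. f (s * t))"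

definition fun_lact :: "'s::semigroup_mult \<Rightarrow> ('s \<Rightarrow> complex) \<Rightarrow> 's \<Rightarrow> complex" where
  "fun_lact s f = (\<lambda>t. f (t * s))"

text \<open>
  Here \<^const>\<open>bcontfun\<close> is \<open>C(S)\<close>; the limits along \<^term>\<open>nhds s\<close> express convergence along every
  net that converges to \<open>s\<close>.
\<close>

definition RUC :: "('s::topological_semigroup_mult \<Rightarrow> complex) set" where
  "RUC = {f \<in> bcontfun. \<forall>s.
            ((\<lambda>t. sup_norm (\<lambda>u. fun_ract f t u - fun_ract f s u)) \<longlongrightarrow> 0) (nhds s)}"

definition LUC :: "('s::topological_semigroup_mult \<Rightarrow> complex) set" where
  "LUC = {f \<in> bcontfun. \<forall>s.
            ((\<lambda>t. sup_norm (\<lambda>u. fun_lact t f u - fun_lact s f u)) \<longlongrightarrow> 0) (nhds s)}"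

definition left_amenable :: "'s::topological_semigroup_mult itself \<Rightarrow> bool" where
  "left_amenable S \<longleftrightarrow>
     (\<exists>m \<in> dual (fun_space (RUC :: ('s \<Rightarrow> complex) set)).
        m (\<lambda>_. 1) = 1 \<and> dual_norm (fun_space RUC) m = 1
        \<and> (\<forall>f\<in>RUC. \<forall>s. m (fun_ract f s) = m f))"

definition right_amenable :: "'s::topological_semigroup_mult itself \<Rightarrow> bool" where
  "right_amenable S \<longleftrightarrow>
     (\<exists>m \<in> dual (fun_space (LUC :: ('s \<Rightarrow> complex) set)).
        m (\<lambda>_. 1) = 1 \<and> dual_norm (fun_space LUC) m = 1
        \<and> (\<forall>f\<in>LUC. \<forall>s. m (fun_lact s f) = m f))"

definition amenable :: "'s::topological_semigroup_mult itself \<Rightarrow> bool" where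
  "amenable S \<longleftrightarrow> left_amenable S \<and> right_amenable S"

end

theory Submission
  imports Defs
begin

text \<open>
  Take the trivial character \<open>\<phi> = 1\<close>. To find an invariant mean on \<open>RUC(S)\<close>, consider the
  quotient of \<open>RUC(S)\<close> by the constants, with trivial left action and right action \<open>f \<cdot> s\<close>. The
  evaluation \<open>\<delta>\<close> at a point \<open>e\<close> is a functional on \<open>RUC(S)\<close>, and \<open>s \<cdot> \<delta> - \<delta>\<close> annihilates the constants,
  so that \<open>s \<mapsto> s \<cdot> \<delta> - \<delta>\<close> is a bounded derivation into the dual of the quotient. If it is
  implemented by a functional \<open>h\<close> that annihilates the constants, then \<open>\<delta> - h\<close> is a bounded invariant
  functional with value 1 at the constant function 1. The quotient is realised as the space of functions
  in \<open>RUC(S)\<close> that vanish at \<open>e\<close>, which is a space of functions on \<open>S\<close> again; the action on it is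
  followed by the subtraction of the value at \<open>e\<close>, and the derivation becomes \<open>s \<mapsto> (f \<mapsto> f (s e))\<close>.

  A bounded invariant functional need not be positive. The real functions in \<open>RUC(S)\<close> form a vector
  lattice, so the real part of the functional has a positive part there. The positive part
  grows weakly under translation, and it is additive; since translations fix the constant functions
  and every function is dominated by a constant, it is in fact invariant (\<open>pos_ext_invariant\<close>). It does not vanish at 1, and
  after normalisation it extends to a complex functional of norm 1 (\<open>invariant_mean\<close>).

  The statement about \<open>LUC(S)\<close> is the same one for the opposite multiplication, with left and right
  actions exchanged. The analysis is therefore done for an associative operation \<open>\<star>\<close>, and the semigroup
  multiplication enters only through the bimodule laws. Left amenability thus follows from right
  character amenability, and right amenability from left character amenability.
\<close>


section \<open>Positive parts of bounded functionals on lattices of functions\<close>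

locale function_lattice =
  fixes V :: "('a \<Rightarrow> real) set"
  assumes const_mem: "(\<lambda>_. c) \<in> V"
    and add_mem: "\<lbrakk>u \<in> V; v \<in> V\<rbrakk> \<Longrightarrow> (\<lambda>x. u x + v x) \<in> V"
    and scale_mem: "u \<in> V \<Longrightarrow> (\<lambda>x. c * u x) \<in> V"
    and max_0_mem: "u \<in> V \<Longrightarrow> (\<lambda>x. max 0 (u x)) \<in> V"
    and bounded_mem: "u \<in> V \<Longrightarrow> \<exists>c. \<forall>x. \<bar>u x\<bar> \<le> c"
begin

lemma diff_mem:
  assumes "u \<in> V" "v \<in> V"
  shows "(\<lambda>x. u x - v x) \<in> V"
  using add_mem[OF assms(1) scale_mem[OF assms(2), of "-1"]] by simp

lemma min_mem:
  assumes "u \<in> V" "v \<in> V"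
  shows "(\<lambda>x. min (u x) (v x)) \<in> V"
proof -
  have "(\<lambda>x. u x - max 0 (u x - v x)) \<in> V"
    by (intro diff_mem max_0_mem assms)
  moreover have "(\<lambda>x. u x - max 0 (u x - v x)) = (\<lambda>x. min (u x) (v x))"
    by (auto simp: fun_eq_iff)
  ultimately show ?thesis by simp
qed

end

locale bounded_functional = function_lattice V
  for V :: "('a \<Rightarrow> real) set" +
  fixes N :: "('a \<Rightarrow> real) \<Rightarrow> real" and K :: real
  assumes N_add: "\<lbrakk>u \<in> V; v \<in> V\<rbrakk> \<Longrightarrow> N (\<lambda>x. u x + v x) = N u + N v"
    and N_scale: "u \<in> V \<Longrightarrow> N (\<lambda>x. c * u x) = c * N u"
    and N_bound: "\<lbrakk>u \<in> V; \<And>x. \<bar>u x\<bar> \<le> c\<rbrakk> \<Longrightarrow> \<bar>N u\<bar> \<le> K * c"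
begin

definition below :: "('a \<Rightarrow> real) \<Rightarrow> ('a \<Rightarrow> real) set" where
  "below u = {g \<in> V. \<forall>x. 0 \<le> g x \<and> g x \<le> u x}"

text \<open>
  The Riesz--Kantorovich formula for the positive part of \<open>N\<close>, meaningful on nonnegative functions only.
\<close>

definition pos_part :: "('a \<Rightarrow> real) \<Rightarrow> real" where
  "pos_part u = (SUP g\<in>below u. N g)"

lemma zero_below: "(\<And>x. 0 \<le> u x) \<Longrightarrow> (\<lambda>_. 0) \<in> below u"
  by (simp add: below_def const_mem)

lemma N_zero: "N (\<lambda>_. 0) = 0"
  using N_scale[OF const_mem, of 0 0] by simp

lemma bdd_above_below:
  assumes "u \<in> V"
  shows "bdd_above (N ` below u)"
proof -
  obtain c where c: "\<And>x. \<bar>u x\<bar> \<le> c" using bounded_mem[OF assms] by blast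
  have "N g \<le> K * c" if "g \<in> below u" for g
  proof -
    have "\<bar>g x\<bar> \<le> c" for x
    proof -
      have "0 \<le> g x" "g x \<le> u x" using that by (auto simp: below_def)
      with c[of x] show ?thesis by linarith
    qed
    then show ?thesis using N_bound[of g c] that by (auto simp: below_def)
  qed
  then show ?thesis by (auto simp: bdd_above_def)
qed

lemma pos_part_upper: "\<lbrakk>u \<in> V; g \<in> below u\<rbrakk> \<Longrightarrow> N g \<le> pos_part u"
  unfolding pos_part_def by (intro cSUP_upper bdd_above_below)

lemma pos_part_least:
  assumes "\<And>x. 0 \<le> u x" "\<And>g. g \<in> below u \<Longrightarrow> N g \<le> b"
  shows "pos_part u \<le> b"
  unfolding pos_part_def using zero_below[of u] assms by (intro cSUP_least) auto

lemma pos_part_nonneg: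
  assumes "u \<in> V" "\<And>x. 0 \<le> u x"
  shows "0 \<le> pos_part u"
  using pos_part_upper[OF assms(1) zero_below] N_zero assms(2) by simp

lemma pos_part_ge:
  assumes "u \<in> V" "\<And>x. 0 \<le> u x"
  shows "N u \<le> pos_part u"
  using assms by (intro pos_part_upper) (auto simp: below_def)

text \<open>
  The Riesz decomposition: a function \<open>0 \<le> g \<le> u + v\<close> splits as the sum of \<open>min g u \<le> u\<close> and a
  remainder that lies below \<open>v\<close>.
\<close>

lemma pos_part_add:
  assumes u: "u \<in> V" "\<And>x. 0 \<le> u x" and v: "v \<in> V" "\<And>x. 0 \<le> v x"
  shows "pos_part (\<lambda>x. u x + v x) = pos_part u + pos_part v"
proof (rule antisym)
  show "pos_part (\<lambda>x. u x + v x) \<le> pos_part u + pos_part v"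
  proof (rule pos_part_least)
    fix g assume g: "g \<in> below (\<lambda>x. u x + v x)"
    define h where "h = (\<lambda>x. min (g x) (u x))"
    have gV: "g \<in> V" using g by (simp add: below_def)
    have hV: "h \<in> V" unfolding h_def by (intro min_mem gV u)
    have rV: "(\<lambda>x. g x - h x) \<in> V" by (intro diff_mem gV hV)
    have hb: "h \<in> below u" using g u hV by (auto simp: below_def h_def)
    have "0 \<le> g x - h x \<and> g x - h x \<le> v x" for x
    proof -
      have "g x \<le> u x + v x" using g by (auto simp: below_def)
      then show ?thesis using v(2)[of x] by (auto simp: h_def min_def)
    qed
    then have rb: "(\<lambda>x. g x - h x) \<in> below v" using rV by (simp add: below_def)
    have "N g = N h + N (\<lambda>x. g x - h x)" using N_add[OF hV rV] by simp
    then show "N g \<le> pos_part u + pos_part v"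
      using pos_part_upper[OF u(1) hb] pos_part_upper[OF v(1) rb] by linarith
  qed (use u v in \<open>simp add: add_nonneg_nonneg\<close>)
next
  have "N h \<le> pos_part (\<lambda>x. u x + v x) - N g" if g: "g \<in> below u" and h: "h \<in> below v" for g h
  proof -
    have "g \<in> V" "h \<in> V" using g h by (auto simp: below_def)
    moreover have "(\<lambda>x. g x + h x) \<in> below (\<lambda>x. u x + v x)"
      using g h by (auto simp: below_def add_mem add_mono)
    ultimately show ?thesis
      using pos_part_upper[OF add_mem[OF u(1) v(1)], of "\<lambda>x. g x + h x"] N_add[of g h] by simp
  qed
  then have "pos_part v \<le> pos_part (\<lambda>x. u x + v x) - N g" if "g \<in> below u" for g
    using that by (intro pos_part_least v)
  then have "N g \<le> pos_part (\<lambda>x. u x + v x) - pos_part v" if "g \<in> below u" for g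
    using that by (simp add: le_diff_eq add.commute)
  then have "pos_part u \<le> pos_part (\<lambda>x. u x + v x) - pos_part v"
    by (intro pos_part_least u)
  then show "pos_part u + pos_part v \<le> pos_part (\<lambda>x. u x + v x)" by simp
qed

lemma pos_part_scale:
  assumes u: "u \<in> V" "\<And>x. 0 \<le> u x" and c: "0 \<le> c"
  shows "pos_part (\<lambda>x. c * u x) = c * pos_part u"
proof -
  have ge: "a * pos_part w \<le> pos_part (\<lambda>x. a * w x)"
    if w: "w \<in> V" "\<And>x. 0 \<le> w x" and a: "0 < a" for a :: real and w
  proof -
    have "pos_part w \<le> pos_part (\<lambda>x. a * w x) / a"
    proof (rule pos_part_least)
      fix g assume g: "g \<in> below w"
      then have "(\<lambda>x. a * g x) \<in> below (\<lambda>x. a * w x)"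
        using a by (auto simp: below_def scale_mem)
      then have "N (\<lambda>x. a * g x) \<le> pos_part (\<lambda>x. a * w x)"
        by (intro pos_part_upper scale_mem w)
      then show "N g \<le> pos_part (\<lambda>x. a * w x) / a"
        using g a N_scale[of g a] by (simp add: below_def field_simps)
    qed (use w in auto)
    then show ?thesis using a by (simp add: field_simps)
  qed
  show ?thesis
  proof (cases "c = 0")
    case True
    have "below (\<lambda>_. 0) = {\<lambda>_. 0}"
      using const_mem[of 0] by (auto simp: below_def fun_eq_iff intro: antisym)
    then show ?thesis using True N_zero by (simp add: pos_part_def)
  next
    case False
    then have c': "0 < c" using c by simp
    have "(1 / c) * pos_part (\<lambda>x. c * u x) \<le> pos_part (\<lambda>x. (1 / c) * (c * u x))"
      using u c' by (intro ge scale_mem) auto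
    then have "pos_part (\<lambda>x. c * u x) \<le> c * pos_part u"
      using c' by (simp add: field_simps)
    with ge[OF u c'] show ?thesis by (intro antisym)
  qed
qed

text \<open>The linear extension of the positive part from the cone of nonnegative functions to \<open>V\<close>.\<close>

definition pos_ext :: "('a \<Rightarrow> real) \<Rightarrow> real" where
  "pos_ext u = pos_part (\<lambda>x. max 0 (u x)) - pos_part (\<lambda>x. max 0 (- u x))"

lemma neg_mem: "u \<in> V \<Longrightarrow> (\<lambda>x. - u x) \<in> V"
  using scale_mem[of u "-1"] by simp

text \<open>
  By additivity on the cone, the value of the extension can be read off from any representation as a
  difference of nonnegative functions.
\<close>

lemma pos_ext_diff:
  assumes a: "a \<in> V" "\<And>x. 0 \<le> a x" and b: "b \<in> V" "\<And>x. 0 \<le> b x"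
  shows "pos_ext (\<lambda>x. a x - b x) = pos_part a - pos_part b"
proof -
  define p where "p = (\<lambda>x. max 0 (a x - b x))"
  define q where "q = (\<lambda>x. max 0 (- (a x - b x)))"
  have p: "p \<in> V" "\<And>x. 0 \<le> p x" and q: "q \<in> V" "\<And>x. 0 \<le> q x"
    unfolding p_def q_def by (auto intro!: max_0_mem neg_mem diff_mem a b)
  have "(\<lambda>x. p x + b x) = (\<lambda>x. a x + q x)" by (auto simp: p_def q_def fun_eq_iff max_def)
  then have "pos_part p + pos_part b = pos_part a + pos_part q"
    using pos_part_add[OF p b] pos_part_add[OF a q] by simp
  then show ?thesis unfolding pos_ext_def p_def q_def by simp
qed

lemma pos_ext_nonneg_eq:
  assumes "u \<in> V" "\<And>x. 0 \<le> u x"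
  shows "pos_ext u = pos_part u"
  using pos_ext_diff[OF assms const_mem[of 0]] pos_part_scale[OF const_mem[of 0], of 0] by simp

lemma obtain_nonneg_diff:
  assumes "u \<in> V"
  obtains a b where "a \<in> V" "\<And>x. 0 \<le> a x" "b \<in> V" "\<And>x. 0 \<le> b x" "u = (\<lambda>x. a x - b x)"
proof
  show "(\<lambda>x. max 0 (u x)) \<in> V" "(\<lambda>x. max 0 (- u x)) \<in> V"
    using assms by (auto intro: max_0_mem neg_mem)
  show "u = (\<lambda>x. max 0 (u x) - max 0 (- u x))" by (rule ext) (simp add: max_def)
qed simp_all

lemma pos_ext_add:
  assumes "u \<in> V" "v \<in> V"
  shows "pos_ext (\<lambda>x. u x + v x) = pos_ext u + pos_ext v"
proof -
  obtain a b where ab: "a \<in> V" "\<And>x. 0 \<le> a x" "b \<in> V" "\<And>x. 0 \<le> b x" "u = (\<lambda>x. a x - b x)"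
    using obtain_nonneg_diff[OF assms(1)] by metis
  obtain c d where cd: "c \<in> V" "\<And>x. 0 \<le> c x" "d \<in> V" "\<And>x. 0 \<le> d x" "v = (\<lambda>x. c x - d x)"
    using obtain_nonneg_diff[OF assms(2)] by metis
  have eq: "(\<lambda>x. u x + v x) = (\<lambda>x. (a x + c x) - (b x + d x))"
    by (simp add: ab cd algebra_simps)
  have "pos_ext (\<lambda>x. u x + v x) = pos_part (\<lambda>x. a x + c x) - pos_part (\<lambda>x. b x + d x)"
    unfolding eq using ab cd by (intro pos_ext_diff add_mem add_nonneg_nonneg) auto
  also have "\<dots> = pos_ext u + pos_ext v"
    using ab(1-4) cd(1-4) by (simp add: pos_ext_diff pos_part_add ab(5) cd(5))
  finally show ?thesis .
qed

lemma pos_ext_scale: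
  assumes "u \<in> V"
  shows "pos_ext (\<lambda>x. c * u x) = c * pos_ext u"
proof -
  obtain a b where ab: "a \<in> V" "\<And>x. 0 \<le> a x" "b \<in> V" "\<And>x. 0 \<le> b x" "u = (\<lambda>x. a x - b x)"
    using obtain_nonneg_diff[OF assms] by metis
  show ?thesis
  proof (cases "0 \<le> c")
    case True
    have "pos_ext (\<lambda>x. c * a x - c * b x) = pos_part (\<lambda>x. c * a x) - pos_part (\<lambda>x. c * b x)"
      using ab True by (intro pos_ext_diff scale_mem) auto
    then show ?thesis
      using ab(1-4) True by (simp add: ab(5) pos_ext_diff pos_part_scale algebra_simps)
  next
    case False
    have "pos_ext (\<lambda>x. (-c) * b x - (-c) * a x)
        = pos_part (\<lambda>x. (-c) * b x) - pos_part (\<lambda>x. (-c) * a x)"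
      using ab False by (intro pos_ext_diff scale_mem) (auto simp: mult_nonpos_nonneg)
    also have "\<dots> = (-c) * pos_part b - (-c) * pos_part a"
      using ab(1-4) False by (simp only: pos_part_scale)
    also have "\<dots> = c * pos_ext u"
      using ab(1-4) by (simp add: ab(5) pos_ext_diff algebra_simps)
    also have "(\<lambda>x. (-c) * b x - (-c) * a x) = (\<lambda>x. c * u x)"
      by (simp add: ab(5) algebra_simps)
    finally show ?thesis .
  qed
qed

lemma pos_ext_sub:
  assumes "u \<in> V" "v \<in> V"
  shows "pos_ext (\<lambda>x. u x - v x) = pos_ext u - pos_ext v"
  using pos_ext_add[OF assms(1) neg_mem[OF assms(2)]] pos_ext_scale[OF assms(2), of "-1"] by simp

lemma pos_ext_const: "pos_ext (\<lambda>_. c) = c * pos_ext (\<lambda>_. 1)"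
  using pos_ext_scale[OF const_mem, of c 1] by simp

lemma pos_ext_nonneg:
  assumes "u \<in> V" "\<And>x. 0 \<le> u x"
  shows "0 \<le> pos_ext u"
  using pos_part_nonneg[OF assms] pos_ext_nonneg_eq[OF assms] by simp

lemma pos_ext_mono_const:
  assumes "u \<in> V" "\<And>x. u x \<le> c"
  shows "pos_ext u \<le> c * pos_ext (\<lambda>_. 1)"
proof -
  have "0 \<le> pos_ext (\<lambda>x. c - u x)"
    using assms by (intro pos_ext_nonneg diff_mem const_mem) auto
  then show ?thesis using pos_ext_sub[OF const_mem assms(1), of c] pos_ext_const[of c] by simp
qed

lemma pos_ext_one_ge: "N (\<lambda>_. 1) \<le> pos_ext (\<lambda>_. 1)"
  using pos_part_ge[OF const_mem, of 1] pos_ext_nonneg_eq[OF const_mem, of 1] by simp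

text \<open>
  A substitution \<open>\<tau>\<close> that preserves \<open>N\<close> maps the functions below \<open>u\<close> to functions below \<open>u \<circ> \<tau>\<close>, which
  only shows that the positive part does not decrease. Equality follows from applying this to the two
  nonnegative functions \<open>c \<plusminus> u\<close> for a constant \<open>c\<close> that dominates \<open>\<bar>u\<bar>\<close>, because \<open>\<tau>\<close> fixes constants.
\<close>

lemma pos_ext_invariant:
  assumes \<tau>: "\<And>u. u \<in> V \<Longrightarrow> (\<lambda>x. u (\<tau> x)) \<in> V" "\<And>u. u \<in> V \<Longrightarrow> N (\<lambda>x. u (\<tau> x)) = N u"
    and u: "u \<in> V"
  shows "pos_ext (\<lambda>x. u (\<tau> x)) = pos_ext u"
proof -
  have mono: "pos_ext w \<le> pos_ext (\<lambda>x. w (\<tau> x))" if w: "w \<in> V" "\<And>x. 0 \<le> w x" for w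
  proof -
    have "pos_part w \<le> pos_part (\<lambda>x. w (\<tau> x))"
    proof (rule pos_part_least)
      fix g assume g: "g \<in> below w"
      then have "(\<lambda>x. g (\<tau> x)) \<in> below (\<lambda>x. w (\<tau> x))" by (auto simp: below_def \<tau>)
      then have "N (\<lambda>x. g (\<tau> x)) \<le> pos_part (\<lambda>x. w (\<tau> x))"
        by (intro pos_part_upper \<tau> w)
      then show "N g \<le> pos_part (\<lambda>x. w (\<tau> x))" using g \<tau> by (simp add: below_def)
    qed (use w in auto)
    then show ?thesis using w \<tau> by (simp add: pos_ext_nonneg_eq)
  qed
  obtain c where c: "\<And>x. \<bar>u x\<bar> \<le> c" using bounded_mem[OF u] by blast
  have "0 \<le> c - u x" "0 \<le> c + u x" for x using c[of x] by linarith+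
  then have "pos_ext (\<lambda>x. c - u x) \<le> pos_ext (\<lambda>x. c - u (\<tau> x))"
    and "pos_ext (\<lambda>x. c + u x) \<le> pos_ext (\<lambda>x. c + u (\<tau> x))"
    using mono[of "\<lambda>x. c - u x"] mono[of "\<lambda>x. c + u x"] by (simp_all add: const_mem diff_mem add_mem u)
  then show ?thesis
    using u \<tau>(1)[OF u] by (simp add: pos_ext_add pos_ext_sub const_mem)
qed

end


section \<open>The sup norm\<close>

lemma cmod_le_sup_norm: "bounded (range f) \<Longrightarrow> cmod (f t) \<le> sup_norm f"
  unfolding sup_norm_def
  by (intro cSUP_upper) (auto simp: bounded_iff bdd_above_def)

lemma sup_norm_le: "(\<And>t. cmod (f t) \<le> c) \<Longrightarrow> sup_norm f \<le> c"
  unfolding sup_norm_def by (intro cSUP_least) auto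

lemma sup_norm_nonneg: "bounded (range f) \<Longrightarrow> 0 \<le> sup_norm f"
  using cmod_le_sup_norm[of f undefined] norm_ge_zero order_trans by blast

lemma sup_norm_one: "sup_norm (\<lambda>_. 1) = 1"
  by (simp add: sup_norm_def)

lemma bounded_range_add:
  fixes f g :: "'a \<Rightarrow> complex"
  assumes "bounded (range f)" "bounded (range g)"
  shows "bounded (range (\<lambda>t. f t + g t))"
  using bounded_plus_comp[OF assms] .

lemma bounded_range_scale:
  fixes f :: "'a \<Rightarrow> complex"
  assumes "bounded (range f)"
  shows "bounded (range (\<lambda>t. c * f t))"
  using bounded_linear_image[OF assms bounded_linear_mult_right[of c]] by (simp add: image_image)

lemma bounded_range_diff:
  fixes f g :: "'a \<Rightarrow> complex"
  assumes "bounded (range f)" "bounded (range g)"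
  shows "bounded (range (\<lambda>t. f t - g t))"
  using bounded_minus_comp[OF assms] .

lemma sup_norm_add:
  assumes "bounded (range f)" "bounded (range g)"
  shows "sup_norm (\<lambda>t. f t + g t) \<le> sup_norm f + sup_norm g"
  by (intro sup_norm_le norm_triangle_mono cmod_le_sup_norm assms)

lemma sup_norm_scale:
  assumes f: "bounded (range f)"
  shows "sup_norm (\<lambda>t. c * f t) = cmod c * sup_norm f"
proof (rule antisym)
  show "sup_norm (\<lambda>t. c * f t) \<le> cmod c * sup_norm f"
    by (intro sup_norm_le) (simp add: norm_mult mult_left_mono cmod_le_sup_norm[OF f])
  show "cmod c * sup_norm f \<le> sup_norm (\<lambda>t. c * f t)"
  proof (cases "c = 0")
    case True
    then show ?thesis by (simp add: sup_norm_def)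
  next
    case False
    have "cmod (f t) \<le> sup_norm (\<lambda>t. c * f t) / cmod c" for t
      using cmod_le_sup_norm[OF bounded_range_scale[OF f], of c t] False
      by (simp add: norm_mult field_simps)
    then have "sup_norm f \<le> sup_norm (\<lambda>t. c * f t) / cmod c" by (rule sup_norm_le)
    then show ?thesis using False by (simp add: field_simps)
  qed
qed

lemma sup_norm_eq_0_iff:
  assumes "bounded (range f)"
  shows "sup_norm f = 0 \<longleftrightarrow> f = (\<lambda>_. 0)"
proof
  assume "sup_norm f = 0"
  then show "f = (\<lambda>_. 0)" using cmod_le_sup_norm[OF assms] by (auto simp: fun_eq_iff)
qed (simp add: sup_norm_def)


section \<open>Banach spaces of bounded functions\<close>

text \<open>
  Closedness is meant in the space of all bounded functions, which is what makes these spaces complete.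
  The record \<open>X\<close> may carry further fields, so that bimodules are covered.
\<close>

locale closed_function_space =
  fixes X :: "('s \<Rightarrow> complex, 'm) normed_module_scheme"
  assumes zero_eq: "\<zero>\<^bsub>X\<^esub> = (\<lambda>_. 0)"
    and add_eq: "add X = (\<lambda>f g t. f t + g t)"
    and smult_eq: "smult X = (\<lambda>c f t. c * f t)"
    and nrm_eq: "nrm X = sup_norm"
    and bounded_range: "f \<in> carrier X \<Longrightarrow> bounded (range f)"
    and zero_mem: "(\<lambda>_. 0) \<in> carrier X"
    and add_mem: "\<lbrakk>f \<in> carrier X; g \<in> carrier X\<rbrakk> \<Longrightarrow> (\<lambda>t. f t + g t) \<in> carrier X"
    and scale_mem: "f \<in> carrier X \<Longrightarrow> (\<lambda>t. c * f t) \<in> carrier X"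
    and limit_mem:
      "\<lbrakk>\<And>n :: nat. F n \<in> carrier X; uniform_limit UNIV F f sequentially\<rbrakk> \<Longrightarrow> f \<in> carrier X"
begin

lemma is_module: "Module.module complex_ring X"
proof (rule moduleI)
  show "cring complex_ring"
  proof (rule cringI)
    show "abelian_group complex_ring"
    proof (rule abelian_groupI)
      fix x
      show "\<exists>y\<in>carrier complex_ring. y \<oplus>\<^bsub>complex_ring\<^esub> x = \<zero>\<^bsub>complex_ring\<^esub>"
        by (rule bexI[of _ "- x"]) (simp_all add: complex_ring_def)
    qed (simp_all add: complex_ring_def)
    show "comm_monoid complex_ring"
      by (rule comm_monoidI) (simp_all add: complex_ring_def)
  qed (simp add: complex_ring_def algebra_simps)
  show "abelian_group X"
  proof (rule abelian_groupI)
    fix x assume "x \<in> carrier X"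
    then show "\<exists>y\<in>carrier X. y \<oplus>\<^bsub>X\<^esub> x = \<zero>\<^bsub>X\<^esub>"
      by (intro bexI[OF _ scale_mem[of x "-1"]]) (simp_all add: add_eq zero_eq)
  qed (simp_all add: add_eq zero_eq add_mem zero_mem add_ac)
qed (simp_all add: complex_ring_def add_eq smult_eq scale_mem algebra_simps)

lemma is_cnormed_space: "cnormed_space X"
  using is_module
  by (intro cnormed_space.intro cnormed_space_axioms.intro)
    (simp_all add: nrm_eq zero_eq add_eq smult_eq bounded_range sup_norm_eq_0_iff
      sup_norm_add sup_norm_scale)

lemma minus_eq:
  assumes f: "f \<in> carrier X" and g: "g \<in> carrier X"
  shows "f \<ominus>\<^bsub>X\<^esub> g = (\<lambda>t. f t - g t)"
proof -
  interpret Module.module complex_ring X by (rule is_module)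
  have "\<ominus>\<^bsub>X\<^esub> g = (\<lambda>t. - 1 * g t)"
    using g by (intro M.minus_equality scale_mem) (simp_all add: add_eq zero_eq)
  then show ?thesis by (simp add: a_minus_def add_eq)
qed

lemma ndist_eq:
  assumes "f \<in> carrier X" "g \<in> carrier X"
  shows "ndist X f g = sup_norm (\<lambda>t. f t - g t)"
  using assms by (simp add: ndist_def minus_eq nrm_eq)

lemma bounded_diff:
  assumes "f \<in> carrier X" "g \<in> carrier X"
  shows "bounded (range (\<lambda>t. f t - g t))"
  using assms by (intro bounded_range_diff bounded_range)

lemma metric: "Metric_space (carrier X) (ndist X)"
proof
  fix f g h
  show "0 \<le> ndist X f g"
  proof (cases "f \<in> carrier X \<and> g \<in> carrier X")
    case True
    then show ?thesis by (simp add: ndist_eq sup_norm_nonneg bounded_diff)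
  qed (auto simp: ndist_def)
  show "ndist X f g = ndist X g f"
  proof (cases "f \<in> carrier X \<and> g \<in> carrier X")
    case True
    then show ?thesis by (simp add: ndist_eq sup_norm_def norm_minus_commute)
  qed (auto simp: ndist_def)
  assume fg: "f \<in> carrier X" "g \<in> carrier X"
  then show "(ndist X f g = 0) = (f = g)"
    by (simp add: ndist_eq sup_norm_eq_0_iff bounded_diff fun_eq_iff)
  assume h: "h \<in> carrier X"
  show "ndist X f h \<le> ndist X f g + ndist X g h"
    using sup_norm_add[OF bounded_diff[OF fg] bounded_diff[OF fg(2) h]] fg h
    by (simp add: ndist_eq)
qed

sublocale Metric_space "carrier X" "ndist X"
  by (rule metric)

lemma mcomplete: mcomplete
  unfolding mcomplete_def
proof (intro allI impI)
  fix F assume "MCauchy F"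
  then have F: "F n \<in> carrier X" for n by (auto simp: MCauchy_def)
  have "uniformly_Cauchy_on UNIV F"
  proof (rule uniformly_Cauchy_onI)
    fix e :: real assume "0 < e"
    then obtain M where M: "\<And>n n'. M \<le> n \<Longrightarrow> M \<le> n' \<Longrightarrow> ndist X (F n) (F n') < e"
      using \<open>MCauchy F\<close> unfolding MCauchy_def by blast
    have "dist (F m x) (F n x) < e" if "M \<le> m" "M \<le> n" for m n x
    proof -
      have "cmod (F m x - F n x) \<le> ndist X (F m) (F n)"
        using cmod_le_sup_norm[OF bounded_diff[OF F F]] by (simp add: ndist_eq F)
      also have "\<dots> < e" using M that .
      finally show ?thesis by (simp add: dist_norm)
    qed
    then show "\<exists>M. \<forall>x\<in>UNIV. \<forall>m\<ge>M. \<forall>n\<ge>M. dist (F m x) (F n x) < e" by blast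
  qed
  then obtain f where f: "uniform_limit UNIV F f sequentially"
    using Cauchy_uniformly_convergent uniformly_convergent_on_def by blast
  have fX: "f \<in> carrier X" using limit_mem[OF F f] .
  have "\<forall>\<^sub>F n in sequentially. ndist X (F n) f < e" if "0 < e" for e
  proof -
    have "\<forall>\<^sub>F n in sequentially. \<forall>x\<in>UNIV. dist (F n x) (f x) < e / 2"
      using f that by (intro uniform_limitD) auto
    then show ?thesis
    proof eventually_elim
      case (elim n)
      then have "sup_norm (\<lambda>t. F n t - f t) \<le> e / 2"
        by (intro sup_norm_le) (auto simp: dist_norm less_imp_le)
      then show ?case using that by (simp add: ndist_eq F fX)
    qed
  qed
  then show "\<exists>f. limitin mtopology F f sequentially"
    using fX F by (auto simp: limitin_metric)
qed

lemma is_cbanach_space: "cbanach_space X"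
  using is_cnormed_space mcomplete by (simp add: cbanach_space_def)

lemma continuous_operator:
  assumes T: "linear_operator X T"
    and K: "\<And>f. f \<in> carrier X \<Longrightarrow> sup_norm (T f) \<le> K * sup_norm f"
  shows "continuous_map mtopology mtopology T"
proof (subst metric_continuous_map[OF metric], intro conjI ballI allI impI)
  show "T ` carrier X \<subseteq> carrier X" using T by (auto simp: linear_operator_def)
next
  fix f and e :: real assume f: "f \<in> carrier X" and e: "0 < e"
  \<comment> \<open>The given bound need not be positive, and a quotient by it is formed below.\<close>
  define L where "L = max K 1"
  have L: "0 < L" by (simp add: L_def)
  have "ndist X (T f) (T g) < e" if g: "g \<in> carrier X" and fg: "ndist X f g < e / L" for g
  proof -
    have mem: "T f \<in> carrier X" "T g \<in> carrier X"
      using T f g by (auto simp: linear_operator_def)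
    have d: "(\<lambda>t. f t + - 1 * g t) \<in> carrier X" by (intro add_mem scale_mem f g)
    have "T (\<lambda>t. - 1 * g t) = (\<lambda>t. - 1 * T g t)"
      using T g unfolding linear_operator_def smult_eq by blast
    moreover have "T (\<lambda>t. f t + - 1 * g t) = (\<lambda>t. T f t + T (\<lambda>t. - 1 * g t) t)"
    proof -
      have "\<forall>x\<in>carrier X. \<forall>y\<in>carrier X. T (\<lambda>t. x t + y t) = (\<lambda>t. T x t + T y t)"
        using T unfolding linear_operator_def add_eq by blast
      from this[rule_format, OF f scale_mem[OF g, of "-1"]] show ?thesis .
    qed
    ultimately have "T (\<lambda>t. f t - g t) = (\<lambda>t. T f t - T g t)" by simp
    then have "ndist X (T f) (T g) \<le> K * sup_norm (\<lambda>t. f t - g t)"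
      using K[OF d] by (simp add: ndist_eq mem)
    also have "\<dots> \<le> L * sup_norm (\<lambda>t. f t - g t)"
      by (intro mult_right_mono sup_norm_nonneg bounded_diff f g) (simp add: L_def)
    also have "\<dots> < e" using fg L by (simp add: ndist_eq f g field_simps)
    finally show ?thesis .
  qed
  then show "\<exists>\<delta>>0. \<forall>g. g \<in> carrier X \<and> ndist X f g < \<delta> \<longrightarrow> ndist X (T f) (T g) < e"
    using e L by (intro exI[of _ "e / L"]) auto
qed

lemma continuous_orbit:
  fixes \<rho> :: "'t::topological_space \<Rightarrow> 's \<Rightarrow> complex"
  assumes mem: "\<And>s. \<rho> s \<in> carrier X"
    and lim: "\<And>s. uniform_limit UNIV \<rho> (\<rho> s) (nhds s)"
  shows "continuous_map euclidean mtopology \<rho>"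
  unfolding continuous_map_to_metric
proof (intro ballI allI impI)
  fix s and e :: real assume e: "0 < e"
  have "\<forall>\<^sub>F t in nhds s. \<forall>x\<in>UNIV. dist (\<rho> t x) (\<rho> s x) < e / 2"
    using lim[of s] e by (intro uniform_limitD) auto
  then obtain U where U: "open U" "s \<in> U" "\<And>t x. t \<in> U \<Longrightarrow> dist (\<rho> t x) (\<rho> s x) < e / 2"
    by (auto simp: eventually_nhds)
  have "ndist X (\<rho> s) (\<rho> t) < e" if "t \<in> U" for t
  proof -
    have "sup_norm (\<lambda>x. \<rho> s x - \<rho> t x) \<le> e / 2"
      using U(3)[OF that] by (intro sup_norm_le) (auto simp: dist_norm norm_minus_commute less_imp_le)
    then show ?thesis using e by (simp add: ndist_eq mem)
  qed
  then show "\<exists>U. openin euclidean U \<and> s \<in> U \<and> (\<forall>t\<in>U. \<rho> t \<in> mball (\<rho> s) e)"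
    using U mem by (intro exI[of _ U]) auto
qed

end


section \<open>Functions with uniformly continuous translates\<close>

text \<open>
  The operation \<open>\<star>\<close> stands for the multiplication of the semigroup or for its opposite. The point \<open>e\<close> is
  arbitrary; it represents the quotient by the constants as the space of functions vanishing at \<open>e\<close>.
\<close>

locale translation_semigroup =
  fixes sop :: "'s::topological_semigroup_mult \<Rightarrow> 's \<Rightarrow> 's" (infixl \<open>\<star>\<close> 70)
    and e :: 's
  assumes assoc: "(s \<star> t) \<star> u = s \<star> (t \<star> u)"
    and continuous_left: "continuous_on UNIV (\<lambda>s. s \<star> t)"
    and continuous_right: "continuous_on UNIV (\<lambda>t. s \<star> t)"
begin

text \<open>This is \<open>RUC\<close> when \<open>\<star>\<close> is the multiplication and \<open>LUC\<close> when it is the opposite multiplication.\<close>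

definition UC :: "('s \<Rightarrow> complex) set" where
  "UC = {f \<in> bcontfun. \<forall>s. ((\<lambda>t. sup_norm (\<lambda>u. f (t \<star> u) - f (s \<star> u))) \<longlongrightarrow> 0) (nhds s)}"

lemma mem_UC_iff:
  "f \<in> UC \<longleftrightarrow> continuous_on UNIV f \<and> bounded (range f)
     \<and> (\<forall>s. uniform_limit UNIV (\<lambda>t u. f (t \<star> u)) (\<lambda>u. f (s \<star> u)) (nhds s))"
proof -
  have "((\<lambda>t. sup_norm (\<lambda>u. f (t \<star> u) - f (s \<star> u))) \<longlongrightarrow> 0) (nhds s)
      \<longleftrightarrow> uniform_limit UNIV (\<lambda>t u. f (t \<star> u)) (\<lambda>u. f (s \<star> u)) (nhds s)" (is "?L \<longleftrightarrow> ?R")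
    if f: "bounded (range f)" for s
  proof -
    have "bounded (range (\<lambda>u. f (t \<star> u)))" for t
      by (rule bounded_subset[OF f]) auto
    then have bd: "bounded (range (\<lambda>u. f (t \<star> u) - f (s \<star> u)))" for t
      by (intro bounded_range_diff)
    show ?thesis
    proof
      assume L: ?L
      show ?R
      proof (rule uniform_limitI)
        fix r :: real assume "0 < r"
        with L have "\<forall>\<^sub>F t in nhds s. dist (sup_norm (\<lambda>u. f (t \<star> u) - f (s \<star> u))) 0 < r"
          by (rule tendstoD)
        then show "\<forall>\<^sub>F t in nhds s. \<forall>u\<in>UNIV. dist (f (t \<star> u)) (f (s \<star> u)) < r"
        proof eventually_elim
          case (elim t)
          show ?case
          proof
            fix u
            show "dist (f (t \<star> u)) (f (s \<star> u)) < r"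
              using elim cmod_le_sup_norm[OF bd, of t u] by (simp add: dist_norm)
          qed
        qed
      qed
    next
      assume R: ?R
      show ?L
      proof (rule tendstoI)
        fix r :: real assume r: "0 < r"
        with R have "\<forall>\<^sub>F t in nhds s. \<forall>u\<in>UNIV. dist (f (t \<star> u)) (f (s \<star> u)) < r / 2"
          by (intro uniform_limitD) auto
        then show "\<forall>\<^sub>F t in nhds s. dist (sup_norm (\<lambda>u. f (t \<star> u) - f (s \<star> u))) 0 < r"
        proof eventually_elim
          case (elim t)
          have "sup_norm (\<lambda>u. f (t \<star> u) - f (s \<star> u)) \<le> r / 2"
            using elim by (intro sup_norm_le) (auto simp: dist_norm less_imp_le)
          then show ?case using r sup_norm_nonneg[OF bd, of t] by simp
        qed
      qed
    qed
  qed
  then show ?thesis by (auto simp: UC_def bcontfun_def)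
qed

lemma UC_bounded: "f \<in> UC \<Longrightarrow> bounded (range f)"
  by (simp add: mem_UC_iff)

lemma UC_const: "(\<lambda>_. c) \<in> UC"
  by (simp add: mem_UC_iff uniform_limit_const image_constant_conv)

lemma UC_add: "\<lbrakk>f \<in> UC; g \<in> UC\<rbrakk> \<Longrightarrow> (\<lambda>t. f t + g t) \<in> UC"
  by (auto simp: mem_UC_iff intro!: continuous_on_add bounded_range_add uniform_limit_add)

text \<open>
  Uniform limits survive composition with a Lipschitz map. This yields in one stroke the closure under
  scalar multiples, real parts and positive parts, which make the real functions in \<open>UC\<close> a vector lattice.
\<close>

lemma UC_compose_Lipschitz:
  assumes f: "f \<in> UC" and g: "\<And>z w. cmod (g z - g w) \<le> L * cmod (z - w)"
  shows "(\<lambda>t. g (f t)) \<in> UC"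
  unfolding mem_UC_iff
proof (intro conjI allI)
  have lip: "(\<bar>L\<bar>)-lipschitz_on UNIV g"
  proof (rule lipschitz_onI)
    fix z w
    have "L * cmod (z - w) \<le> \<bar>L\<bar> * cmod (z - w)" by (intro mult_right_mono) auto
    with g[of z w] show "dist (g z) (g w) \<le> \<bar>L\<bar> * dist z w" by (simp add: dist_norm)
  qed simp
  show "continuous_on UNIV (\<lambda>t. g (f t))"
    using continuous_on_compose2[OF lipschitz_on_continuous_on[OF lip], of UNIV f] f
    by (simp add: mem_UC_iff)
  show "bounded (range (\<lambda>t. g (f t)))"
    using bounded_uniformly_continuous_image
        [OF lipschitz_on_uniformly_continuous[OF lipschitz_on_subset[OF lip]] UC_bounded[OF f]]
    by (simp add: image_image)
  show "uniform_limit UNIV (\<lambda>t u. g (f (t \<star> u))) (\<lambda>u. g (f (s \<star> u))) (nhds s)" for s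
    using f by (intro uniform_limit_compose_uniformly_continuous_on
        [OF _ lipschitz_on_uniformly_continuous[OF lip]]) (auto simp: mem_UC_iff)
qed

lemma UC_scale:
  assumes "f \<in> UC" shows "(\<lambda>t. c * f t) \<in> UC"
  using assms
  by (rule UC_compose_Lipschitz[of _ _ "cmod c"])
    (simp add: norm_mult flip: right_diff_distrib)

lemma UC_diff: "\<lbrakk>f \<in> UC; g \<in> UC\<rbrakk> \<Longrightarrow> (\<lambda>t. f t - g t) \<in> UC"
  using UC_add[OF _ UC_scale[of g "-1"]] by simp

lemma UC_Re:
  assumes "f \<in> UC" shows "(\<lambda>t. complex_of_real (Re (f t))) \<in> UC"
  using assms
proof (rule UC_compose_Lipschitz[of _ _ 1])
  show "cmod (complex_of_real (Re z) - complex_of_real (Re w)) \<le> 1 * cmod (z - w)" for z w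
    using abs_Re_le_cmod[of "z - w"] by (simp flip: of_real_diff)
qed

lemma UC_Im:
  assumes "f \<in> UC" shows "(\<lambda>t. complex_of_real (Im (f t))) \<in> UC"
  using UC_Re[OF UC_scale[OF assms, of "- \<i>"]] by simp

lemma UC_max_0:
  assumes "f \<in> UC" shows "(\<lambda>t. complex_of_real (max 0 (Re (f t)))) \<in> UC"
  using assms
proof (rule UC_compose_Lipschitz[of _ _ 1])
  show "cmod (complex_of_real (max 0 (Re z)) - complex_of_real (max 0 (Re w))) \<le> 1 * cmod (z - w)"
    for z w
    using abs_Re_le_cmod[of "z - w"] by (auto simp: max_def simp flip: of_real_diff)
qed

text \<open>
  Translating by \<open>t\<close> after \<open>s\<close> is translating by \<open>s \<star> t\<close>, and \<open>t \<mapsto> s \<star> t\<close> is continuous.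
\<close>

lemma UC_translate:
  assumes f: "f \<in> UC" shows "(\<lambda>t. f (s \<star> t)) \<in> UC"
  unfolding mem_UC_iff
proof (intro conjI allI)
  show "continuous_on UNIV (\<lambda>t. f (s \<star> t))"
    using f continuous_on_compose2[OF _ continuous_right] by (auto simp: mem_UC_iff)
  show "bounded (range (\<lambda>t. f (s \<star> t)))"
    by (rule bounded_subset[OF UC_bounded[OF f]]) auto
  fix r
  have lim: "filterlim (\<lambda>t. s \<star> t) (nhds (s \<star> r)) (nhds r)"
    using continuous_right[of s] by (simp add: continuous_on_def tendsto_at_iff_tendsto_nhds)
  have "uniform_limit UNIV (\<lambda>t u. f (t \<star> u)) (\<lambda>u. f ((s \<star> r) \<star> u)) (nhds (s \<star> r))"
    using f by (simp add: mem_UC_iff)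
  then have "uniform_limit UNIV (\<lambda>t u. f ((s \<star> t) \<star> u)) (\<lambda>u. f ((s \<star> r) \<star> u)) (nhds r)"
    using lim by (rule filterlim_compose)
  then show "uniform_limit UNIV (\<lambda>t u. f (s \<star> (t \<star> u))) (\<lambda>u. f (s \<star> (r \<star> u))) (nhds r)"
    by (simp add: assoc)
qed

lemma UC_limit:
  fixes F :: "nat \<Rightarrow> 's \<Rightarrow> complex"
  assumes F: "\<And>n. F n \<in> UC" and lim: "uniform_limit UNIV F f sequentially"
  shows "f \<in> UC"
  unfolding mem_UC_iff
proof (intro conjI allI)
  show "continuous_on UNIV f"
    using F by (intro uniform_limit_theorem[OF _ lim]) (auto simp: mem_UC_iff)
  show "bounded (range f)"
    using uniform_limit_bounded[OF lim] F by (simp add: mem_UC_iff)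
  fix s
  show "uniform_limit UNIV (\<lambda>t u. f (t \<star> u)) (\<lambda>u. f (s \<star> u)) (nhds s)"
  proof (rule uniform_limitI)
    fix r :: real assume r: "0 < r"
    then obtain n where n: "\<And>x. dist (F n x) (f x) < r / 3"
      using uniform_limitD[OF lim, of "r / 3"] by (auto simp: eventually_sequentially)
    have "\<forall>\<^sub>F t in nhds s. \<forall>u\<in>UNIV. dist (F n (t \<star> u)) (F n (s \<star> u)) < r / 3"
      using F[of n] r by (intro uniform_limitD) (auto simp: mem_UC_iff)
    then show "\<forall>\<^sub>F t in nhds s. \<forall>u\<in>UNIV. dist (f (t \<star> u)) (f (s \<star> u)) < r"
    proof eventually_elim
      case (elim t)
      show ?case
      proof
        fix u
        have t: "dist (f (t \<star> u)) (F n (t \<star> u)) < r / 3" using n by (simp add: dist_commute)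
        have ts: "dist (F n (t \<star> u)) (F n (s \<star> u)) < r / 3" using elim by blast
        show "dist (f (t \<star> u)) (f (s \<star> u)) < r" by (rule dist_triangle_third[OF t ts n])
      qed
    qed
  qed
qed


section \<open>From invariant functionals to invariant means\<close>

text \<open>
  The real functional to which the positive part is applied is the real part of \<open>n\<close>, restricted to real
  functions; its value at 1 is still 1, which keeps the positive part from vanishing at 1. Translates of
  real functions are real, so it inherits the invariance of \<open>n\<close>.
\<close>

lemma invariant_mean:
  fixes n :: "('s \<Rightarrow> complex) \<Rightarrow> complex"
  assumes n_add: "\<And>f g. \<lbrakk>f \<in> UC; g \<in> UC\<rbrakk> \<Longrightarrow> n (\<lambda>t. f t + g t) = n f + n g"
    and n_scale: "\<And>f c. f \<in> UC \<Longrightarrow> n (\<lambda>t. c * f t) = c * n f"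
    and n_bound: "\<And>f. f \<in> UC \<Longrightarrow> cmod (n f) \<le> K * sup_norm f"
    and n_one: "n (\<lambda>_. 1) = 1"
    and n_invariant: "\<And>f s. f \<in> UC \<Longrightarrow> n (\<lambda>t. f (s \<star> t)) = n f"
  shows "\<exists>m \<in> dual (fun_space UC). m (\<lambda>_. 1) = 1 \<and> dual_norm (fun_space UC) m = 1
           \<and> (\<forall>f\<in>UC. \<forall>s. m (\<lambda>t. f (s \<star> t)) = m f)"
proof -
  define V where "V = {u. (\<lambda>t. complex_of_real (u t)) \<in> UC}"
  define N where "N u = Re (n (\<lambda>t. complex_of_real (u t)))" for u
  interpret bounded_functional V N "\<bar>K\<bar>"
  proof
    show "(\<lambda>_. c) \<in> V" for c by (simp add: V_def UC_const)
    show "(\<lambda>x. u x + v x) \<in> V" if "u \<in> V" "v \<in> V" for u v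
      using UC_add that by (simp add: V_def)
    show "(\<lambda>x. c * u x) \<in> V" if "u \<in> V" for u c
      using UC_scale that by (simp add: V_def)
    show "(\<lambda>x. max 0 (u x)) \<in> V" if "u \<in> V" for u
      using UC_max_0 that by (fastforce simp: V_def)
    show "\<exists>c. \<forall>x. \<bar>u x\<bar> \<le> c" if "u \<in> V" for u
      using UC_bounded that by (fastforce simp: V_def bounded_iff)
    show "N (\<lambda>x. u x + v x) = N u + N v" if "u \<in> V" "v \<in> V" for u v
      using that by (simp add: V_def N_def n_add)
    show "N (\<lambda>x. c * u x) = c * N u" if "u \<in> V" for u c
      using that by (simp add: V_def N_def n_scale)
    show "\<bar>N u\<bar> \<le> \<bar>K\<bar> * c" if u: "u \<in> V" and c: "\<And>x. \<bar>u x\<bar> \<le> c" for u c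
    proof -
      let ?f = "\<lambda>t. complex_of_real (u t)"
      have f: "?f \<in> UC" using u by (simp add: V_def)
      have "\<bar>N u\<bar> \<le> cmod (n ?f)" unfolding N_def by (rule abs_Re_le_cmod)
      also have "\<dots> \<le> K * sup_norm ?f" by (rule n_bound[OF f])
      also have "\<dots> \<le> \<bar>K\<bar> * sup_norm ?f"
        by (intro mult_right_mono sup_norm_nonneg UC_bounded f) simp
      also have "\<dots> \<le> \<bar>K\<bar> * c" using c by (intro mult_left_mono sup_norm_le) auto
      finally show ?thesis .
    qed
  qed
  define q where "q = pos_ext (\<lambda>_. 1)"
  have q: "0 < q" using pos_ext_one_ge by (simp add: q_def N_def n_one)
  define m where
    "m f = Complex (pos_ext (\<lambda>t. Re (f t)) / q) (pos_ext (\<lambda>t. Im (f t)) / q)" for f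
  have ReV: "(\<lambda>t. Re (f t)) \<in> V" and ImV: "(\<lambda>t. Im (f t)) \<in> V" if "f \<in> UC" for f
    using UC_Re UC_Im that by (auto simp: V_def)
  have m_add: "m (\<lambda>t. f t + g t) = m f + m g" if "f \<in> UC" "g \<in> UC" for f g
    using that by (simp add: m_def complex_eq_iff pos_ext_add ReV ImV add_divide_distrib)
  have m_scale: "m (\<lambda>t. c * f t) = c * m f" if f: "f \<in> UC" for f c
    using ReV[OF f] ImV[OF f]
    by (simp add: m_def complex_eq_iff pos_ext_add pos_ext_sub pos_ext_scale scale_mem
        add_divide_distrib diff_divide_distrib)
  have m_one: "m (\<lambda>_. 1) = 1"
    using q pos_ext_const[of 0] by (simp add: m_def complex_eq_iff flip: q_def)
  have m_bound: "cmod (m f) \<le> sup_norm f" if f: "f \<in> UC" for f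
  proof (cases "m f = 0")
    case True
    then show ?thesis using sup_norm_nonneg[OF UC_bounded[OF f]] by simp
  next
    case False
    \<comment> \<open>Rotating the value of the functional onto the positive real axis leaves only a real part.\<close>
    define w where "w = cnj (m f) / cmod (m f)"
    have w: "cmod w = 1" "w * m f = cmod (m f)"
      using False by (simp_all add: w_def norm_divide complex_norm_square[symmetric] power2_eq_square mult.commute)
    have "cmod (m f) = Re (m (\<lambda>t. w * f t))" using m_scale[OF f] w by simp
    also have "\<dots> = pos_ext (\<lambda>t. Re (w * f t)) / q" by (simp add: m_def)
    also have "\<dots> \<le> sup_norm f * q / q"
    proof (intro divide_right_mono)
      have "Re (w * f t) \<le> sup_norm f" for t
        using complex_Re_le_cmod[of "w * f t"] cmod_le_sup_norm[OF UC_bounded[OF f], of t] w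
        by (simp add: norm_mult)
      then show "pos_ext (\<lambda>t. Re (w * f t)) \<le> sup_norm f * q"
        unfolding q_def by (intro pos_ext_mono_const ReV UC_scale f)
    qed (use q in simp)
    finally show ?thesis using q by simp
  qed
  have m_invariant: "m (\<lambda>t. f (s \<star> t)) = m f" if f: "f \<in> UC" for f s
  proof -
    have V: "(\<lambda>t. u (s \<star> t)) \<in> V" if "u \<in> V" for u
      using UC_translate that by (simp add: V_def)
    have N: "N (\<lambda>t. u (s \<star> t)) = N u" if "u \<in> V" for u
      using n_invariant[of "\<lambda>t. complex_of_real (u t)"] that by (simp add: V_def N_def)
    show ?thesis
      unfolding m_def
      using pos_ext_invariant[of "\<lambda>t. s \<star> t", OF V N, OF _ _ ReV[OF f]]
        pos_ext_invariant[of "\<lambda>t. s \<star> t", OF V N, OF _ _ ImV[OF f]] by simp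
  qed
  have dual: "m \<in> dual (fun_space UC)"
    using m_add m_scale m_bound by (auto simp: dual_def fun_space_def intro!: exI[of _ 1])
  have "dual_norm (fun_space UC) m = 1"
    unfolding dual_norm_def
  proof (rule cSup_eq_maximum)
    show "1 \<in> (\<lambda>f. cmod (m f)) ` {f \<in> carrier (fun_space UC). nrm (fun_space UC) f \<le> 1}"
      by (rule image_eqI[of _ _ "\<lambda>_. 1"]) (auto simp: m_one fun_space_def UC_const sup_norm_one)
    show "x \<le> 1" if "x \<in> (\<lambda>f. cmod (m f)) ` {f \<in> carrier (fun_space UC). nrm (fun_space UC) f \<le> 1}" for x
      using that m_bound by (fastforce simp: fun_space_def)
  qed
  then show ?thesis using dual m_one m_invariant by blast
qed


section \<open>The bimodule of functions vanishing at a point\<close>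

definition UC0 :: "('s \<Rightarrow> complex) set" where
  "UC0 = {f \<in> UC. f e = 0}"

text \<open>Translation on \<open>UC\<close> modulo the constants, read off on the representatives that vanish at \<open>e\<close>.\<close>

definition act :: "'s \<Rightarrow> ('s \<Rightarrow> complex) \<Rightarrow> 's \<Rightarrow> complex" where
  "act s f = (\<lambda>t. f (s \<star> t) - f (s \<star> e))"

lemma UC0_imp_UC: "f \<in> UC0 \<Longrightarrow> f \<in> UC"
  by (simp add: UC0_def)

lemma act_mem: "f \<in> UC0 \<Longrightarrow> act s f \<in> UC0"
  by (simp add: UC0_def act_def UC_diff UC_translate UC_const)

lemma act_act: "act t (act s f) = act (s \<star> t) f"
  by (simp add: act_def fun_eq_iff assoc)

text \<open>
  The functional \<open>h\<close> on \<open>UC0\<close> extends to \<open>UC\<close> by \<open>f \<mapsto> h (f - f e)\<close>, and the last hypothesis says that on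
  \<open>UC0\<close> evaluation at \<open>e\<close> and \<open>h\<close> change by the same amount under translation. Their difference is the
  invariant functional \<open>n\<close>.
\<close>

lemma invariant_mean_of_coboundary:
  fixes h :: "('s \<Rightarrow> complex) \<Rightarrow> complex"
  assumes h_add: "\<And>f g. \<lbrakk>f \<in> UC0; g \<in> UC0\<rbrakk> \<Longrightarrow> h (\<lambda>t. f t + g t) = h f + h g"
    and h_scale: "\<And>f c. f \<in> UC0 \<Longrightarrow> h (\<lambda>t. c * f t) = c * h f"
    and h_bound: "\<And>f. f \<in> UC0 \<Longrightarrow> cmod (h f) \<le> K * sup_norm f"
    and h_act: "\<And>f s. f \<in> UC0 \<Longrightarrow> f (s \<star> e) = h (act s f) - h f"
  shows "\<exists>m \<in> dual (fun_space UC). m (\<lambda>_. 1) = 1 \<and> dual_norm (fun_space UC) m = 1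
           \<and> (\<forall>f\<in>UC. \<forall>s. m (\<lambda>t. f (s \<star> t)) = m f)"
proof -
  define c where "c f = (\<lambda>t. f t - f e)" for f :: "'s \<Rightarrow> complex"
  define n where "n f = f e - h (c f)" for f
  have c: "c f \<in> UC0" if "f \<in> UC" for f
    using that by (simp add: c_def UC0_def UC_diff UC_const)
  have c_bound: "sup_norm (c f) \<le> 2 * sup_norm f" if "f \<in> UC" for f
  proof (rule sup_norm_le)
    fix t
    show "cmod (c f t) \<le> 2 * sup_norm f"
      using norm_triangle_ineq4[of "f t" "f e"] cmod_le_sup_norm[OF UC_bounded[OF that], of t]
        cmod_le_sup_norm[OF UC_bounded[OF that], of e] by (simp add: c_def)
  qed
  have h_zero: "h (\<lambda>_. 0) = 0"
    using h_scale[of "\<lambda>_. 0" 0] UC_const by (simp add: UC0_def)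
  show ?thesis
  proof (rule invariant_mean[of n "1 + \<bar>K\<bar> * 2"])
    show "n (\<lambda>t. f t + g t) = n f + n g" if "f \<in> UC" "g \<in> UC" for f g
    proof -
      have "c (\<lambda>t. f t + g t) = (\<lambda>t. c f t + c g t)" by (simp add: c_def fun_eq_iff)
      then show ?thesis using h_add[OF c c] that by (simp add: n_def)
    qed
    show "n (\<lambda>t. a * f t) = a * n f" if "f \<in> UC" for f a
    proof -
      have "c (\<lambda>t. a * f t) = (\<lambda>t. a * c f t)" by (simp add: c_def fun_eq_iff right_diff_distrib)
      then show ?thesis using h_scale[OF c] that by (simp add: n_def right_diff_distrib)
    qed
    show "cmod (n f) \<le> (1 + \<bar>K\<bar> * 2) * sup_norm f" if f: "f \<in> UC" for f
    proof -
      have "cmod (h (c f)) \<le> K * sup_norm (c f)" by (rule h_bound[OF c[OF f]])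
      also have "\<dots> \<le> \<bar>K\<bar> * sup_norm (c f)"
        by (intro mult_right_mono sup_norm_nonneg UC_bounded UC0_imp_UC c f) simp
      also have "\<dots> \<le> \<bar>K\<bar> * (2 * sup_norm f)" by (intro mult_left_mono c_bound f) simp
      finally show ?thesis
        using norm_triangle_ineq4[of "f e" "h (c f)"] cmod_le_sup_norm[OF UC_bounded[OF f], of e]
        by (simp add: n_def algebra_simps)
    qed
    show "n (\<lambda>_. 1) = 1" by (simp add: n_def c_def h_zero)
    show "n (\<lambda>t. f (s \<star> t)) = n f" if f: "f \<in> UC" for f s
    proof -
      have "c (\<lambda>t. f (s \<star> t)) = act s (c f)" by (simp add: c_def act_def fun_eq_iff)
      moreover have "h (act s (c f)) = c f (s \<star> e) + h (c f)" using h_act[OF c[OF f], of s] by simp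
      ultimately show ?thesis by (simp add: n_def) (simp add: c_def)
    qed
  qed
qed

text \<open>
  Both actions are parameters, because the trivial action is on the left for one kind of
  character amenability and on the right for the other.
\<close>

definition UC0_bimodule ::
    "('s \<Rightarrow> ('s \<Rightarrow> complex) \<Rightarrow> 's \<Rightarrow> complex) \<Rightarrow> (('s \<Rightarrow> complex) \<Rightarrow> 's \<Rightarrow> 's \<Rightarrow> complex)
      \<Rightarrow> ('s, 's \<Rightarrow> complex) bimodule" where
  "UC0_bimodule L R =
     \<lparr>carrier = UC0, monoid.mult = (\<lambda>f g t. f t * g t), one = (\<lambda>_. 1), zero = (\<lambda>_. 0),
      add = (\<lambda>f g t. f t + g t), smult = (\<lambda>c f t. c * f t), nrm = sup_norm, lact = L, ract = R\<rparr>"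

lemma UC0_bimodule_simps [simp]:
  "carrier (UC0_bimodule L R) = UC0" "zero (UC0_bimodule L R) = (\<lambda>_. 0)"
  "add (UC0_bimodule L R) = (\<lambda>f g t. f t + g t)" "smult (UC0_bimodule L R) = (\<lambda>c f t. c * f t)"
  "nrm (UC0_bimodule L R) = sup_norm" "lact (UC0_bimodule L R) = L" "ract (UC0_bimodule L R) = R"
  by (simp_all add: UC0_bimodule_def)

lemma closed_function_space_UC0: "closed_function_space (UC0_bimodule L R)"
proof
  fix F :: "nat \<Rightarrow> 's \<Rightarrow> complex" and f
  assume F: "\<And>n. F n \<in> carrier (UC0_bimodule L R)" and lim: "uniform_limit UNIV F f sequentially"
  have "f \<in> UC" using F by (intro UC_limit[OF _ lim]) (simp add: UC0_imp_UC)
  moreover have "(\<lambda>n. F n e) \<longlonglongrightarrow> f e" using lim by (rule tendsto_uniform_limitI) simp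
  then have "f e = 0" using F by (simp add: UC0_def LIMSEQ_const_iff)
  ultimately show "f \<in> carrier (UC0_bimodule L R)" by (simp add: UC0_def)
qed (auto simp: UC0_def UC_bounded UC_const UC_add UC_scale)

text \<open>
  The properties of a one-sided action that a bimodule asks for, apart from compatibility
  with the multiplication. The constant 2 is the one that translation followed by subtraction of a
  value costs.
\<close>

definition bounded_action :: "('s \<Rightarrow> ('s \<Rightarrow> complex) \<Rightarrow> 's \<Rightarrow> complex) \<Rightarrow> bool" where
  "bounded_action \<rho> \<longleftrightarrow>
     (\<forall>s. \<forall>f\<in>UC0. \<rho> s f \<in> UC0 \<and> sup_norm (\<rho> s f) \<le> 2 * sup_norm f
        \<and> uniform_limit UNIV (\<lambda>t. \<rho> t f) (\<rho> s f) (nhds s))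
     \<and> (\<forall>s. \<forall>f\<in>UC0. \<forall>g\<in>UC0. \<rho> s (\<lambda>t. f t + g t) = (\<lambda>t. \<rho> s f t + \<rho> s g t))
     \<and> (\<forall>s c. \<forall>f\<in>UC0. \<rho> s (\<lambda>t. c * f t) = (\<lambda>t. c * \<rho> s f t))"

lemma bounded_action_trivial: "bounded_action (\<lambda>s f. f)"
proof -
  have "sup_norm f \<le> 2 * sup_norm f" if "f \<in> UC0" for f
    using sup_norm_nonneg[OF UC_bounded[OF UC0_imp_UC[OF that]]] by simp
  then show ?thesis by (simp add: bounded_action_def uniform_limit_const)
qed

lemma bounded_action_act: "bounded_action act"
proof -
  have "sup_norm (act s f) \<le> 2 * sup_norm f" if f: "f \<in> UC0" for s f
  proof (rule sup_norm_le)
    fix t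
    note le = cmod_le_sup_norm[OF UC_bounded[OF UC0_imp_UC[OF f]]]
    show "cmod (act s f t) \<le> 2 * sup_norm f"
      using norm_triangle_ineq4[of "f (s \<star> t)" "f (s \<star> e)"] le[of "s \<star> t"] le[of "s \<star> e"]
      by (simp add: act_def)
  qed
  moreover have "uniform_limit UNIV (\<lambda>t. act t f) (act s f) (nhds s)" if f: "f \<in> UC0" for s f
  proof -
    have lim: "uniform_limit UNIV (\<lambda>t u. f (t \<star> u)) (\<lambda>u. f (s \<star> u)) (nhds s)"
      using UC0_imp_UC[OF f] by (simp add: mem_UC_iff)
    have "uniform_limit UNIV (\<lambda>t u. f (t \<star> e)) (\<lambda>u. f (s \<star> e)) (nhds s)"
      by (rule uniform_limit_compose'[OF lim]) simp
    with lim show ?thesis unfolding act_def by (rule uniform_limit_minus)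
  qed
  ultimately show ?thesis
    by (simp add: bounded_action_def act_mem)
      (simp add: act_def fun_eq_iff right_diff_distrib)
qed

lemma banach_bimodule_UC0:
  assumes L: "bounded_action L" and R: "bounded_action (\<lambda>s f. R f s)"
    and LL: "\<And>s t f. f \<in> UC0 \<Longrightarrow> L (s * t) f = L s (L t f)"
    and RR: "\<And>s t f. f \<in> UC0 \<Longrightarrow> R f (s * t) = R (R f s) t"
    and LR: "\<And>s t f. f \<in> UC0 \<Longrightarrow> R (L s f) t = L s (R f t)"
  shows "banach_bimodule (UC0_bimodule L R)"
proof -
  let ?X = "UC0_bimodule L R"
  interpret closed_function_space ?X by (rule closed_function_space_UC0)
  have linear: "linear_operator ?X (\<rho> s)" if "bounded_action \<rho>" for \<rho> s
    using that by (auto simp: linear_operator_def bounded_action_def)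
  have continuous: "continuous_map (ntopology ?X) (ntopology ?X) (\<rho> s)" if "bounded_action \<rho>" for \<rho> s
    using that by (intro continuous_operator[of _ 2] linear) (auto simp: bounded_action_def)
  have orbit: "continuous_map euclidean (ntopology ?X) (\<lambda>s. \<rho> s f)"
    if "bounded_action \<rho>" "f \<in> UC0" for \<rho> f
    using that by (intro continuous_orbit) (auto simp: bounded_action_def)
  show ?thesis
  proof
    show "cbanach_space ?X" by (rule is_cbanach_space)
    show "linear_operator ?X (\<lambda>x. lact ?X s x)" "linear_operator ?X (\<lambda>x. ract ?X x s)" for s
      using linear[OF L] linear[OF R] by simp_all
    show "continuous_map (ntopology ?X) (ntopology ?X) (\<lambda>x. lact ?X s x)"
      "continuous_map (ntopology ?X) (ntopology ?X) (\<lambda>x. ract ?X x s)" for s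
      using continuous[OF L] continuous[OF R] by simp_all
    show "continuous_map euclidean (ntopology ?X) (\<lambda>s. lact ?X s x)"
      "continuous_map euclidean (ntopology ?X) (\<lambda>s. ract ?X x s)" if "x \<in> carrier ?X" for x
      using orbit[OF L] orbit[OF R] that by simp_all
    show "\<exists>K. \<forall>s. \<forall>x\<in>carrier ?X. nrm ?X (lact ?X s x) \<le> K * nrm ?X x"
      "\<exists>K. \<forall>s. \<forall>x\<in>carrier ?X. nrm ?X (ract ?X x s) \<le> K * nrm ?X x"
      using L R by (auto simp: bounded_action_def intro!: exI[of _ 2])
  qed (simp_all add: LL RR LR)
qed

text \<open>
  On \<open>UC\<close> the map \<open>s \<mapsto> (f \<mapsto> f (s \<star> e) - f e)\<close> is the coboundary of evaluation at \<open>e\<close>, hence a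
  derivation. On \<open>UC0\<close> the second term is zero, but so is evaluation at \<open>e\<close>: there it is a derivation
  that is no longer principal for an obvious reason.
\<close>

lemma bounded_derivation_evaluation:
  assumes "\<And>s t f. f \<in> UC0 \<Longrightarrow> f ((s * t) \<star> e) = R f s (t \<star> e) + L t f (s \<star> e)"
  shows "bounded_derivation (UC0_bimodule L R) (\<lambda>s f. f (s \<star> e))"
  unfolding bounded_derivation_def
proof (intro conjI allI ballI)
  let ?X = "UC0_bimodule L R"
  note le = cmod_le_sup_norm[OF UC_bounded[OF UC0_imp_UC]]
  show "range (\<lambda>s f. f (s \<star> e)) \<subseteq> dual ?X"
    using le by (auto simp: dual_def intro!: exI[of _ 1])
  show "f ((s * t) \<star> e) = dual_lact ?X s (\<lambda>f. f (t \<star> e)) f + dual_ract ?X (\<lambda>f. f (s \<star> e)) t f"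
    if "f \<in> carrier ?X" for s t f
    using assms that by (simp add: dual_lact_def dual_ract_def)
  show "continuous_on UNIV (\<lambda>s. f (s \<star> e))" if "f \<in> carrier ?X" for f
    using that continuous_on_compose2[OF _ continuous_left, of UNIV f]
    by (simp add: UC0_def mem_UC_iff)
  have "dual_norm ?X (\<lambda>f. f (s \<star> e)) \<le> 1" for s
    unfolding dual_norm_def
  proof (rule cSUP_least)
    have "(\<lambda>_. 0) \<in> {x \<in> carrier ?X. nrm ?X x \<le> 1}"
      by (simp add: UC0_def UC_const sup_norm_def)
    then show "{x \<in> carrier ?X. nrm ?X x \<le> 1} \<noteq> {}" by blast
  qed (use le in \<open>force intro: order_trans\<close>)
  then show "bdd_above (range (\<lambda>s. dual_norm ?X (\<lambda>f. f (s \<star> e))))"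
    by (auto simp: bdd_above_def)
qed

end


section \<open>Character amenability implies amenability\<close>

lemma one_mem_characters: "(\<lambda>_. 1) \<in> characters"
  by (auto simp: characters_def fun_eq_iff)

text \<open>
  The sides cross: a left invariant mean is fixed by the dual of the right action \<open>f \<cdot> s\<close>, so the left
  action is the one given by the character.
\<close>

lemma right_character_amenable_imp_left_amenable:
  assumes "right_character_amenable TYPE('s::topological_semigroup_mult)"
  shows "left_amenable TYPE('s)"
proof -
  interpret translation_semigroup "(*) :: 's \<Rightarrow> 's \<Rightarrow> 's" undefined
    by unfold_locales
      (auto simp: mult.assoc continuous_on_def intro!: tendsto_mult tendsto_const tendsto_ident_at)
  let ?X = "UC0_bimodule (\<lambda>s f. f) (\<lambda>f s. act s f)"
  have UC_eq: "UC = RUC" by (simp add: UC_def RUC_def fun_ract_def)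
  have "banach_bimodule ?X"
    by (rule banach_bimodule_UC0) (simp_all add: bounded_action_trivial bounded_action_act act_act)
  then have X: "?X \<in> left_char_modules (\<lambda>_. 1)" by (simp add: left_char_modules_def)
  have D: "bounded_derivation ?X (\<lambda>s f. f (s * undefined))"
    by (rule bounded_derivation_evaluation) (simp add: act_def mult.assoc)
  have "principal_derivation ?X (\<lambda>s f. f (s * undefined))"
    using assms X D one_mem_characters unfolding right_character_amenable_def by blast
  then obtain h where h: "h \<in> dual ?X"
    and h_act: "\<And>s f. f \<in> UC0 \<Longrightarrow> f (s * undefined) = h (act s f) - h f"
    by (auto simp: principal_derivation_def dual_lact_def dual_ract_def)
  have "\<exists>K. \<forall>f\<in>UC0. cmod (h f) \<le> K * sup_norm f" using h by (simp add: dual_def)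
  then obtain K where K: "\<And>f. f \<in> UC0 \<Longrightarrow> cmod (h f) \<le> K * sup_norm f" by blast
  have "\<exists>m \<in> dual (fun_space UC). m (\<lambda>_. 1) = 1 \<and> dual_norm (fun_space UC) m = 1
           \<and> (\<forall>f\<in>UC. \<forall>s. m (\<lambda>t. f (s * t)) = m f)"
    using h by (intro invariant_mean_of_coboundary[of h, OF _ _ K h_act]) (auto simp: dual_def)
  then show ?thesis by (simp add: left_amenable_def UC_eq fun_ract_def)
qed

lemma left_character_amenable_imp_right_amenable:
  assumes "left_character_amenable TYPE('s::topological_semigroup_mult)"
  shows "right_amenable TYPE('s)"
proof -
  interpret translation_semigroup "\<lambda>s t :: 's. t * s" undefined
    by unfold_locales
      (auto simp: mult.assoc continuous_on_def intro!: tendsto_mult tendsto_const tendsto_ident_at)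
  let ?X = "UC0_bimodule act (\<lambda>f s. f)"
  have UC_eq: "UC = LUC" by (simp add: UC_def LUC_def fun_lact_def)
  have "banach_bimodule ?X"
    by (rule banach_bimodule_UC0) (simp_all add: bounded_action_trivial bounded_action_act act_act)
  then have X: "?X \<in> right_char_modules (\<lambda>_. 1)" by (simp add: right_char_modules_def)
  have D: "bounded_derivation ?X (\<lambda>s f. f (undefined * s))"
    by (rule bounded_derivation_evaluation) (simp add: act_def mult.assoc)
  have "principal_derivation ?X (\<lambda>s f. f (undefined * s))"
    using assms X D one_mem_characters unfolding left_character_amenable_def by blast
  then obtain g where g: "g \<in> dual ?X"
    and g_act: "\<And>s f. f \<in> UC0 \<Longrightarrow> f (undefined * s) = g f - g (act s f)"
    by (auto simp: principal_derivation_def dual_lact_def dual_ract_def)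
  have "\<exists>K. \<forall>f\<in>UC0. cmod (g f) \<le> K * sup_norm f" using g by (simp add: dual_def)
  then obtain K where K: "\<And>f. f \<in> UC0 \<Longrightarrow> cmod (g f) \<le> K * sup_norm f" by blast
  \<comment> \<open>With the nontrivial action on the left, the principal derivation has the opposite sign.\<close>
  have "\<exists>m \<in> dual (fun_space UC). m (\<lambda>_. 1) = 1 \<and> dual_norm (fun_space UC) m = 1
           \<and> (\<forall>f\<in>UC. \<forall>s. m (\<lambda>t. f (t * s)) = m f)"
    using g g_act K by (intro invariant_mean_of_coboundary[of "\<lambda>f. - g f" K]) (auto simp: dual_def)
  then show ?thesis by (simp add: right_amenable_def UC_eq fun_lact_def)
qed

theorem corollary2p7:
  assumes "character_amenable TYPE('s::topological_semigroup_mult)"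
  shows "amenable TYPE('s)"
  using assms right_character_amenable_imp_left_amenable left_character_amenable_imp_right_amenable
  by (auto simp: character_amenable_def amenable_def)

end
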